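(* Let $t$ be a positive integer, $g$ a function on partitions and $\mu$ a partition. For $n\in\mathbb N$ let $P_g(n)=\sum_{\lambda\ge_t\mu,\ |\lambda|-|\mu|=nt}F_{\lambda/\mu}\,g(\lambda)$. Then for every $n\in\mathbb N$, $$P_g(n)=\sum_{k=0}^n\binom nk D_t^kg(\mu)\qquad\text{and}\qquad D_t^ng(\mu)=\sum_{k=0}^n(-1)^{n+k}\binom nk P_g(k).$$ In particular, if there is a positive integer $r$ such that $D_t^rg(\lambda)=0$ for every partition $\lambda\ge_t\mu$, then $P_g(n)$ is a polynomial in $n$.
   Context: The 01-sequence $(z_i)_{i\in\mathbb Z}$ of a partition: traverse the boundary of its Young diagram from the bottom (infinite vertical ray below the first column) to the right (infinite horizontal ray right of the first row), labelling vertical edges $0$ and horizontal edges $1$, indexed so that $\#\{i\ge0:z_i=0\}=\#\{i<0:z_i=1\}$. Adding a $t$-hook means exchanging some $z_i=0,z_{i+t}=1$ into $1,0$. $\lambda\ge_t\mu$ means $\lambda$ is obtained from $\mu$ by adding a (possibly empty) sequence of $t$-hooks. $F_{\lambda/\mu}$ (for $\lambda\ge_t\mu$): $F_{\mu/\mu}=1$ and $F_{\lambda/\mu}=\sum F_{\lambda^-/\mu}$ over all $\lambda^-$ with $\lambda\ge_t\lambda^-\ge_t\mu$ and $|\lambda|-|\lambda^-|=t$. For a function $g$ on partitions, $D_tg(\lambda)=\sum_{\lambda^+}g(\lambda^+)-g(\lambda)$, the sum over all partitions $\lambda^+$ obtained from $\lambda$ by adding one $t$-hook; $D_t^0g=g$,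 $D_t^kg=D_t(D_t^{k-1}g)$, and $D_t^kg(\mu)$ denotes the value of $D_t^kg$ at $\mu$. *)

theory Defs
  imports Complex_Main "HOL-Computational_Algebra.Polynomial"
begin

text \<open>A partition is a weakly decreasing sequence of natural numbers with finitely many nonzero
  terms; \<open>part \<mu> r\<close> is the length of row \<open>r\<close>, rows and columns being counted from \<open>0\<close>.\<close>

typedef partition = "{f :: nat \<Rightarrow> nat. antimono f \<and> finite {r. f r \<noteq> 0}}"
  morphisms part Abs_partition
  by (rule exI [of _ "\<lambda>_. 0"]) (simp add: antimono_def)

definition psize :: "partition \<Rightarrow> nat" where
  "psize \<mu> = (\<Sum>r | part \<mu> r \<noteq> 0. part \<mu> r)"

definition diagram :: "partition \<Rightarrow> (nat \<times> nat) set" where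
  "diagram \<mu> = {(r, c). c < part \<mu> r}"

text \<open>The lattice point \<open>(r, c)\<close> is the top left corner of the cell \<open>(r, c)\<close> (row \<open>r\<close>, column \<open>c\<close>;
  row \<open>0\<close> is on top). The boundary consists of the edges having a cell outside the diagram on
  their lower right side and, on the other side, a cell of the diagram or no cell at all
  (the latter on the two rays).\<close>

definition vertical_edge :: "partition \<Rightarrow> nat \<times> nat \<Rightarrow> nat \<times> nat \<Rightarrow> bool" where
  "vertical_edge \<mu> p q \<longleftrightarrow> (\<exists>r c. p = (Suc r, c) \<and> q = (r, c) \<and>
     (r, c) \<notin> diagram \<mu> \<and> (c = 0 \<or> (r, c - 1) \<in> diagram \<mu>))"

definition horizontal_edge :: "partition \<Rightarrow> nat \<times> nat \<Rightarrow> nat \<times> nat \<Rightarrow> bool" where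
  "horizontal_edge \<mu> p q \<longleftrightarrow> (\<exists>r c. p = (r, c) \<and> q = (r, Suc c) \<and>
     (r, c) \<notin> diagram \<mu> \<and> (r = 0 \<or> (r - 1, c) \<in> diagram \<mu>))"

text \<open>The \<open>i\<close>-th edge of the traversal runs from \<open>v i\<close> to \<open>v (i + 1)\<close> and is labelled \<open>z i\<close>.
  All steps go up or to the right, so a bi-infinite traversal comes from the vertical ray and
  leaves along the horizontal ray.\<close>

definition boundary_labelling :: "partition \<Rightarrow> (int \<Rightarrow> nat) \<Rightarrow> bool" where
  "boundary_labelling \<mu> z \<longleftrightarrow> (\<exists>v. \<forall>i.
     z i = 0 \<and> vertical_edge \<mu> (v i) (v (i + 1)) \<or>
     z i = 1 \<and> horizontal_edge \<mu> (v i) (v (i + 1)))"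

definition zero_one_seq :: "partition \<Rightarrow> int \<Rightarrow> nat" where
  "zero_one_seq \<mu> = (THE z. boundary_labelling \<mu> z \<and>
     card {i. i \<ge> 0 \<and> z i = 0} = card {i. i < 0 \<and> z i = 1})"

lemma antimono_part: "r \<le> s \<Longrightarrow> part \<mu> s \<le> part \<mu> r"
  using part [of \<mu>] by (auto simp: antimono_def)

text \<open>The labelling in the definition of \<open>zero_one_seq\<close> exists and is unique: the edge of row \<open>r\<close>
  on the boundary has index \<open>part \<mu> r - r - 1\<close>.\<close>

definition vertical_index :: "partition \<Rightarrow> int \<Rightarrow> bool" where
  "vertical_index \<mu> i \<longleftrightarrow> (\<exists>r. i = int (part \<mu> r) - int r - 1)"

lemma boundary_labelling_shift:
  assumes "boundary_labelling \<mu> z"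
  obtains k where "\<And>i. z i = (if vertical_index \<mu> (i + k) then 0 else 1)"
proof -
  obtain v where v: "\<And>i. z i = 0 \<and> vertical_edge \<mu> (v i) (v (i + 1)) \<or>
     z i = 1 \<and> horizontal_edge \<mu> (v i) (v (i + 1))"
    using assms by (auto simp: boundary_labelling_def)
  define h where "h i = int (snd (v i)) - int (fst (v i))" for i
  have step: "h (i + 1) = h i + 1" for i
    using v [of i] by (auto simp: h_def vertical_edge_def horizontal_edge_def)
  have h: "h i = i + h 0" for i
  proof (induction i rule: int_induct [where k = 0])
    case (step2 i)
    then show ?case using step [of "i - 1"] by simp
  qed (auto simp: step)
  have "z i = (if vertical_index \<mu> (i + h 0) then 0 else 1)" for i
    using v [of i]
  proof
    assume a: "z i = 0 \<and> vertical_edge \<mu> (v i) (v (i + 1))"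
    then obtain r c where rc: "v i = (Suc r, c)" "part \<mu> r \<le> c" "c = 0 \<or> c - 1 < part \<mu> r"
      by (auto simp: vertical_edge_def diagram_def)
    then have "c = part \<mu> r" by auto
    then have "h i = int (part \<mu> r) - int r - 1" using rc by (simp add: h_def)
    then show ?thesis using a h [of i] by (auto simp: vertical_index_def)
  next
    assume a: "z i = 1 \<and> horizontal_edge \<mu> (v i) (v (i + 1))"
    then obtain r c where rc: "v i = (r, c)" "part \<mu> r \<le> c" "r = 0 \<or> c < part \<mu> (r - 1)"
      by (auto simp: horizontal_edge_def diagram_def)
    have "int c - int r \<noteq> int (part \<mu> s) - int s - 1" for s
    proof (cases "r \<le> s")
      case True
      then show ?thesis using antimono_part [of r s \<mu>] rc by auto
    next
      case False
      then have "s \<le> r - 1" by simp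
      then show ?thesis using antimono_part [of s "r - 1" \<mu>] rc False by auto
    qed
    then have "\<not> vertical_index \<mu> (i + h 0)"
      using h [of i] rc by (simp add: vertical_index_def h_def)
    then show ?thesis using a by simp
  qed
  then show thesis by (rule that)
qed

lemma charge:
  "int (card {i. i \<ge> k \<and> vertical_index \<mu> i}) + k = int (card {i. i < k \<and> \<not> vertical_index \<mu> i})"
proof -
  define b where "b r = int (part \<mu> r) - int r - 1" for r
  have b_less: "b s < b r" if "r < s" for r s
    using antimono_part [of r s \<mu>] that by (simp add: b_def)
  have inj: "inj b"
    by (rule injI) (metis b_less less_irrefl nat_neq_iff)
  have "finite {r. part \<mu> r \<noteq> 0}" using part [of \<mu>] by simp
  then obtain M where M: "\<And>r. part \<mu> r \<noteq> 0 \<Longrightarrow> r < M"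
    unfolding finite_nat_set_iff_bounded by blast
  define N where "N = max M (nat (- k))"
  have N: "part \<mu> r = 0" if "r \<ge> N" for r
    using M [of r] that by (auto simp: N_def)
  have Nk: "- int N \<le> k" by (auto simp: N_def)
  have zeros: "{i. i \<ge> - int N \<and> vertical_index \<mu> i} = b ` {..<N}" (is "?L = ?R")
  proof (intro equalityI subsetI)
    fix i assume "i \<in> ?L"
    then obtain r where r: "i = b r" "b r \<ge> - int N" by (auto simp: vertical_index_def b_def)
    then have "r < N" using N [of r] by (cases "r < N") (auto simp: b_def)
    then show "i \<in> ?R" using r by auto
  qed (auto simp: vertical_index_def b_def)
  let ?A = "{i. i \<ge> k \<and> vertical_index \<mu> i}"
  let ?B = "{i. - int N \<le> i \<and> i < k \<and> vertical_index \<mu> i}"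
  let ?C = "{i. i < k \<and> \<not> vertical_index \<mu> i}"
  have AB: "?A \<union> ?B = b ` {..<N}" unfolding zeros [symmetric] using Nk by auto
  have fin: "finite ?A" "finite ?B" by (rule finite_subset [of _ "b ` {..<N}"], use AB in blast, simp)+
  have "card (?A \<union> ?B) = card ?A + card ?B" by (rule card_Un_disjoint) (use fin in auto)
  moreover have "card (?A \<union> ?B) = N"
    unfolding AB using inj by (simp add: card_image inj_on_def)
  ultimately have 1: "card ?A + card ?B = N" by simp
  have low: "vertical_index \<mu> i" if "i < - int N" for i
    unfolding vertical_index_def
    by (rule exI [of _ "nat (- i - 1)"]) (use N [of "nat (- i - 1)"] that in auto)
  have BC: "?B \<union> ?C = {- int N..<k}" by auto (meson linorder_not_le low)
  have finC: "finite ?C" by (rule finite_subset [of _ "{- int N..<k}"]) (use BC in auto)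
  have "card (?B \<union> ?C) = card ?B + card ?C" by (rule card_Un_disjoint) (use fin finC in auto)
  moreover have "int (card (?B \<union> ?C)) = k + int N" unfolding BC using Nk by simp
  ultimately show ?thesis using 1 by linarith
qed

lemma boundary_labelling_exists:
  "boundary_labelling \<mu> (\<lambda>i. if vertical_index \<mu> i then 0 else 1)"
proof -
  define R where "R i = (LEAST r. int (part \<mu> r) \<le> i + int r)" for i
  have ex: "\<exists>r. int (part \<mu> r) \<le> i + int r" for i
    by (rule exI [of _ "part \<mu> 0 + nat (- i)"])
      (use antimono_part [of 0 "part \<mu> 0 + nat (- i)" \<mu>] in linarith)
  have R1: "int (part \<mu> (R i)) \<le> i + int (R i)" for i
    unfolding R_def by (rule LeastI_ex [OF ex])
  have R2: "i + int r < int (part \<mu> r)" if "r < R i" for i r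
    using not_less_Least that unfolding R_def by fastforce
  have R3: "R i = r" if "int (part \<mu> r) \<le> i + int r" "r > 0 \<Longrightarrow> i + int (r - 1) < int (part \<mu> (r - 1))" for i r
  proof (rule antisym)
    show "R i \<le> r" unfolding R_def using that(1) by (rule Least_le)
    show "r \<le> R i"
    proof (rule ccontr)
      assume "\<not> r \<le> R i"
      then have "R i \<le> r - 1" "r > 0" by simp_all
      then show False using that(2) R1 [of i] antimono_part [of "R i" "r - 1" \<mu>] by linarith
    qed
  qed
  define v where "v i = (R i, nat (i + int (R i)))" for i
  have "(if vertical_index \<mu> i then 0 else 1) = (0 :: nat) \<and> vertical_edge \<mu> (v i) (v (i + 1)) \<or>
     (if vertical_index \<mu> i then 0 else 1) = (1 :: nat) \<and> horizontal_edge \<mu> (v i) (v (i + 1))" for i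
  proof (cases "vertical_index \<mu> i")
    case True
    then obtain r where r: "i = int (part \<mu> r) - int r - 1" by (auto simp: vertical_index_def)
    have "R i = Suc r" by (rule R3) (use r antimono_part [of r "Suc r" \<mu>] in auto)
    moreover have "R (i + 1) = r"
      by (rule R3) (use r antimono_part [of "r - 1" r \<mu>] in auto)
    ultimately have "vertical_edge \<mu> (v i) (v (i + 1))"
      using r by (auto simp: vertical_edge_def v_def diagram_def)
    then show ?thesis using True by simp
  next
    case False
    have *: "i + 1 + int (R i - 1) < int (part \<mu> (R i - 1))" if "R i > 0"
    proof -
      have "i + int (R i - 1) < int (part \<mu> (R i - 1))" using R2 [of "R i - 1" i] that by simp
      moreover have "i \<noteq> int (part \<mu> (R i - 1)) - int (R i - 1) - 1"
        using False by (auto simp: vertical_index_def)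
      ultimately show ?thesis by linarith
    qed
    have "R (i + 1) = R i" by (rule R3) (use R1 [of i] * in auto)
    moreover have "nat (i + int (R i)) < part \<mu> (R i - 1)" if "R i > 0"
      using R1 [of i] * [OF that] that by linarith
    moreover have "nat (i + 1 + int (R i)) = Suc (nat (i + int (R i)))"
      using R1 [of i] by linarith
    ultimately have "horizontal_edge \<mu> (v i) (v (i + 1))"
      using R1 [of i] by (auto simp: horizontal_edge_def v_def diagram_def)
    then show ?thesis using False by simp
  qed
  then show ?thesis unfolding boundary_labelling_def by blast
qed

lemma zero_one_seq_eq: "zero_one_seq \<mu> i = (if vertical_index \<mu> i then 0 else 1)"
proof -
  have "zero_one_seq \<mu> = (\<lambda>i. if vertical_index \<mu> i then 0 else 1)"
    unfolding zero_one_seq_def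
  proof (rule the_equality)
    have eq: "{i. i \<ge> 0 \<and> (if vertical_index \<mu> i then 0 else 1) = (0 :: nat)} = {i. i \<ge> 0 \<and> vertical_index \<mu> i}"
      "{i. i < 0 \<and> (if vertical_index \<mu> i then 0 else 1) = (1 :: nat)} = {i. i < 0 \<and> \<not> vertical_index \<mu> i}"
      by auto
    show "boundary_labelling \<mu> (\<lambda>i. if vertical_index \<mu> i then 0 else 1) \<and>
      card {i. i \<ge> 0 \<and> (if vertical_index \<mu> i then 0 else 1) = (0 :: nat)} =
      card {i. i < 0 \<and> (if vertical_index \<mu> i then 0 else 1) = (1 :: nat)}"
      unfolding eq using charge [of 0 \<mu>] boundary_labelling_exists [of \<mu>] by simp
  next
    fix z assume z: "boundary_labelling \<mu> z \<and>
      card {i. i \<ge> 0 \<and> z i = 0} = card {i. i < 0 \<and> z i = 1}"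
    then obtain k where k: "\<And>i. z i = (if vertical_index \<mu> (i + k) then 0 else 1)"
      using boundary_labelling_shift by blast
    have shift: "card {i. P (i + k)} = card {i. P i}" for P
    proof -
      have "bij_betw (\<lambda>i. i + k) {i. P (i + k)} {i. P i}"
        by (rule bij_betw_byWitness [where f' = "\<lambda>i. i - k"]) auto
      then show ?thesis by (rule bij_betw_same_card)
    qed
    have eq: "{i. i \<ge> 0 \<and> z i = 0} = {i. i \<ge> 0 \<and> vertical_index \<mu> (i + k)}"
      "{i. i < 0 \<and> z i = 1} = {i. i < 0 \<and> \<not> vertical_index \<mu> (i + k)}"
      by (auto simp: k)
    have "card {i. i \<ge> 0 \<and> z i = 0} = card {i. i \<ge> k \<and> vertical_index \<mu> i}"
      using shift [of "\<lambda>i. i \<ge> k \<and> vertical_index \<mu> i"] by (simp only: eq) simp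
    moreover have "card {i. i < 0 \<and> z i = 1} = card {i. i < k \<and> \<not> vertical_index \<mu> i}"
      using shift [of "\<lambda>i. i < k \<and> \<not> vertical_index \<mu> i"] by (simp only: eq) simp
    ultimately have "k = 0" using charge [of k \<mu>] z by simp
    then show "z = (\<lambda>i. if vertical_index \<mu> i then 0 else 1)" by (simp add: k fun_eq_iff)
  qed
  then show ?thesis by simp
qed

definition add_hook :: "nat \<Rightarrow> partition \<Rightarrow> partition \<Rightarrow> bool" where
  "add_hook t \<mu> \<kappa> \<longleftrightarrow> (\<exists>i. zero_one_seq \<mu> i = 0 \<and> zero_one_seq \<mu> (i + int t) = 1 \<and>
     zero_one_seq \<kappa> = (zero_one_seq \<mu>)(i := 1, i + int t := 0))"

definition hook_ge :: "nat \<Rightarrow> partition \<Rightarrow> partition \<Rightarrow> bool" where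
  "hook_ge t \<kappa> \<mu> \<longleftrightarrow> (add_hook t)\<^sup>*\<^sup>* \<mu> \<kappa>"

text \<open>For \<open>t > 0\<close> this is $F_{\kappa/\mu}$ (and \<open>0\<close> unless \<open>hook_ge t \<kappa> \<mu>\<close>); the value for \<open>t = 0\<close> and
  \<open>\<kappa> \<noteq> \<mu>\<close> is junk, there only to make the recursion terminate.\<close>

function hook_paths :: "nat \<Rightarrow> partition \<Rightarrow> partition \<Rightarrow> nat" where
  "hook_paths t \<kappa> \<mu> =
     (if \<kappa> = \<mu> then 1
      else if t = 0 then 0
      else \<Sum>\<nu> | hook_ge t \<kappa> \<nu> \<and> hook_ge t \<nu> \<mu> \<and> psize \<kappa> = psize \<nu> + t. hook_paths t \<nu> \<mu>)"
  by pat_completeness auto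
termination
  by (relation "measure (\<lambda>(t, \<kappa>, \<mu>). psize \<kappa>)") auto

declare hook_paths.simps [simp del]

definition hook_diff :: "nat \<Rightarrow> (partition \<Rightarrow> 'a) \<Rightarrow> partition \<Rightarrow> 'a :: field_char_0" where
  "hook_diff t g \<mu> = (\<Sum>\<kappa> | add_hook t \<mu> \<kappa>. g \<kappa>) - g \<mu>"

definition hook_sum :: "nat \<Rightarrow> partition \<Rightarrow> (partition \<Rightarrow> 'a) \<Rightarrow> nat \<Rightarrow> 'a :: field_char_0" where
  "hook_sum t \<mu> g n =
     (\<Sum>\<kappa> | hook_ge t \<kappa> \<mu> \<and> psize \<kappa> = psize \<mu> + n * t. of_nat (hook_paths t \<kappa> \<mu>) * g \<kappa>)"

end

theory Submission
  imports Defs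
begin

text \<open>Exchanging the order of summation gives \<open>P_g(n + 1) = P_g(n) + P_{D g}(n)\<close>. With
  \<open>a m n = P_{D^m g}(n)\<close> this reads \<open>a m (n + 1) = a m n + a (m + 1) n\<close>, and solving it for
  \<open>a 0 n\<close> in terms of \<open>a k 0\<close>, respectively for \<open>a n 0\<close> in terms of \<open>a 0 k\<close>, yields the two identities.
  That a \<open>t\<close>-hook has \<open>t\<close> cells is seen from the sum of the positions of the zeros of the
  01-sequence to the right of a position far to the left.\<close>

text \<open>Pascal's rule and induction on \<open>n\<close>, with \<open>m\<close> arbitrary because
  the second summand raises it. The factor \<open>c\<close> serves both identities:
  \<open>c = 1\<close> expands sums in differences, \<open>c = - 1\<close> inverts this.\<close>

lemma binomial_recursion:
  fixes a :: "nat \<Rightarrow> nat \<Rightarrow> 'a :: comm_ring_1"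
  assumes "\<And>m n. a m (Suc n) = c * a m n + a (Suc m) n"
  shows "a m n = (\<Sum>k\<le>n. of_nat (n choose k) * c ^ (n - k) * a (m + k) 0)"
proof (induction n arbitrary: m)
  case (Suc n)
  let ?f = "\<lambda>k. of_nat (n choose k) * c ^ (Suc n - k) * a (m + k) 0"
  have "c * a m n = (\<Sum>k\<le>n. ?f k)"
    by (subst Suc) (auto simp: sum_distrib_left Suc_diff_le mult_ac intro!: sum.cong)
  \<comment> \<open>The new term vanishes since \<open>n choose Suc n = 0\<close>; it is added so
    that splitting off index \<open>0\<close> leaves a sum over \<open>k \<le> n\<close>.\<close>
  also have "\<dots> = (\<Sum>k\<le>Suc n. ?f k)"
    by (simp add: binomial_eq_0)
  also have "\<dots> = ?f 0 + (\<Sum>k\<le>n. ?f (Suc k))"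
    by (rule sum.atMost_Suc_shift)
  finally have 1: "c * a m n = ?f 0 + (\<Sum>k\<le>n. ?f (Suc k))" .
  have 2: "a (Suc m) n = (\<Sum>k\<le>n. of_nat (n choose k) * c ^ (n - k) * a (m + Suc k) 0)"
    by (subst Suc) simp
  show ?case
    by (subst sum.atMost_Suc_shift)
      (simp add: assms 1 2 sum.distrib [symmetric] algebra_simps)
qed simp

text \<open>The witness is the falling factorial X (X - 1) ... (X - k + 1) divided by k!.\<close>

lemma of_nat_binomial_poly:
  "\<exists>p :: 'a :: field_char_0 poly. \<forall>n. of_nat (n choose k) = poly p (of_nat n)"
  by (rule exI [of _ "smult (inverse (fact k)) (\<Prod>i<k. [:- of_nat i, 1:])"])
    (simp add: binomial_gbinomial gbinomial_prod_rev poly_prod field_simps lessThan_atLeast0)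

lemma finite_part: "finite {r. part \<mu> r \<noteq> 0}"
  using part [of \<mu>] by simp

lemma part_le_psize: "part \<mu> r \<le> psize \<mu>"
  unfolding psize_def
  by (cases "part \<mu> r = 0") (use finite_part [of \<mu>] in \<open>auto intro: member_le_sum\<close>)

text \<open>If row \<open>r\<close> were nonempty, so would be all rows above it, which makes at
  least \<open>Suc r\<close> cells.\<close>

lemma part_eq_0:
  assumes "psize \<mu> \<le> r"
  shows "part \<mu> r = 0"
proof (rule ccontr)
  assume "part \<mu> r \<noteq> 0"
  then have pos: "part \<mu> s \<noteq> 0" if "s \<le> r" for s
    using antimono_part [OF that, of \<mu>] by simp
  have "Suc r = (\<Sum>s\<le>r. 1)" by simp
  also have "\<dots> \<le> (\<Sum>s\<le>r. part \<mu> s)"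
    using pos by (intro sum_mono) (simp add: Suc_leI)
  also have "\<dots> \<le> psize \<mu>"
    unfolding psize_def by (rule sum_mono2) (use pos finite_part in auto)
  finally show False using assms by simp
qed

text \<open>A partition of \<open>n\<close> is determined by its first \<open>n\<close> rows, each
  of length at most \<open>n\<close>.\<close>

lemma finite_psize: "finite {\<mu>. psize \<mu> = n}"
proof -
  have "part ` {\<mu>. psize \<mu> = n} \<subseteq> {f. \<forall>r. (r \<in> {..<n} \<longrightarrow> f r \<in> {..n}) \<and> (r \<notin> {..<n} \<longrightarrow> f r = 0)}"
    by (auto simp: part_le_psize part_eq_0)
  then have "finite (part ` {\<mu>. psize \<mu> = n})"
    by (rule finite_subset) (intro finite_set_of_finite_funs finite_lessThan finite_atMost)
  then show ?thesis
    by (rule finite_imageD) (simp add: inj_on_def part_inject)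
qed

text \<open>Row \<open>r\<close> contributes the zero at \<open>part \<mu> r - r - 1\<close>. Rows
  from \<open>N\<close> on are empty and have their zeros below \<open>- N\<close>, so the cut-off
  keeps exactly the rows \<open>r < N\<close> and makes the sum finite.\<close>

lemma psize_vertical_indices:
  assumes "psize \<mu> \<le> N"
  shows "int (psize \<mu>) = (\<Sum>j | - int N \<le> j \<and> vertical_index \<mu> j. j) + (\<Sum>r<N. int r + 1)"
    and "finite {j. - int N \<le> j \<and> vertical_index \<mu> j}"
proof -
  define b where "b r = int (part \<mu> r) - int r - 1" for r
  have b_less: "b s < b r" if "r < s" for r s
    using antimono_part [of r s \<mu>] that by (simp add: b_def)
  have inj: "inj_on b {..<N}"
    by (rule inj_onI) (metis b_less less_irrefl nat_neq_iff)
  have zero: "part \<mu> r = 0" if "N \<le> r" for r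
    using part_eq_0 that assms by simp
  have img: "{j. - int N \<le> j \<and> vertical_index \<mu> j} = b ` {..<N}" (is "?L = ?R")
  proof (intro equalityI subsetI)
    fix j assume "j \<in> ?L"
    then obtain r where r: "j = b r" "b r \<ge> - int N" by (auto simp: vertical_index_def b_def)
    then have "r < N" using zero [of r] by (cases "r < N") (auto simp: b_def)
    then show "j \<in> ?R" using r by auto
  qed (auto simp: vertical_index_def b_def)
  then show "finite ?L" by simp
  have "psize \<mu> = (\<Sum>r<N. part \<mu> r)"
    unfolding psize_def by (rule sum.mono_neutral_left) (use zero not_less in auto)
  also have "int \<dots> = (\<Sum>r<N. b r) + (\<Sum>r<N. int r + 1)"
    by (simp add: b_def sum.distrib [symmetric] algebra_simps)
  also have "(\<Sum>r<N. b r) = (\<Sum>j\<in>?L. j)"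
    unfolding img by (simp add: sum.reindex [OF inj])
  finally show "int (psize \<mu>) = (\<Sum>j\<in>?L. j) + (\<Sum>r<N. int r + 1)" .
qed

lemma psize_add_hook:
  assumes "add_hook t \<mu> \<kappa>" "t > 0"
  shows "psize \<kappa> = psize \<mu> + t"
proof -
  obtain i where 0: "zero_one_seq \<mu> i = 0" "zero_one_seq \<mu> (i + int t) = 1"
    and z: "zero_one_seq \<kappa> = (zero_one_seq \<mu>)(i := 1, i + int t := 0)"
    using assms(1) unfolding add_hook_def by blast
  have i: "vertical_index \<mu> i" "\<not> vertical_index \<mu> (i + int t)"
    using 0 by (simp_all add: zero_one_seq_eq split: if_splits)
  have k: "vertical_index \<kappa> j \<longleftrightarrow> j = i + int t \<or> j \<noteq> i \<and> vertical_index \<mu> j" for j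
    using fun_cong [OF z, of j] \<open>t > 0\<close> by (auto simp: zero_one_seq_eq split: if_splits)
  \<comment> \<open>One cut-off for both partitions, so that the correction terms cancel, and low
    enough to keep the moved zero \<open>i\<close> in view.\<close>
  define N where "N = psize \<mu> + psize \<kappa> + nat (- i)"
  have N: "psize \<mu> \<le> N" "psize \<kappa> \<le> N" "- int N \<le> i" by (auto simp: N_def)
  let ?V = "{j. - int N \<le> j \<and> vertical_index \<mu> j}"
  have V: "{j. - int N \<le> j \<and> vertical_index \<kappa> j} = insert (i + int t) (?V - {i})"
    using N by (auto simp: k)
  have fin: "finite ?V" using N(1) by (rule psize_vertical_indices)
  have "\<Sum>?V = i + \<Sum>(?V - {i})"
    using fin i N by (intro sum.remove) auto
  moreover have "\<Sum>(insert (i + int t) (?V - {i})) = i + int t + \<Sum>(?V - {i})"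
    using fin i by (intro sum.insert) auto
  ultimately show ?thesis
    using psize_vertical_indices(1) [OF N(1)] psize_vertical_indices(1) [OF N(2)] V by simp
qed

lemma hook_ge_psize:
  assumes "hook_ge t \<kappa> \<mu>" "t > 0"
  shows "psize \<mu> \<le> psize \<kappa>"
  using assms(1) unfolding hook_ge_def
  by (induction rule: rtranclp_induct) (use psize_add_hook [OF _ \<open>t > 0\<close>] in fastforce)+

lemma hook_ge_add_hook: "add_hook t \<nu> \<kappa> \<Longrightarrow> hook_ge t \<nu> \<mu> \<Longrightarrow> hook_ge t \<kappa> \<mu>"
  unfolding hook_ge_def by (rule rtranclp.rtrancl_into_rtrancl)

lemma hook_ge_psize_eq:
  assumes "hook_ge t \<kappa> \<mu>" "psize \<kappa> = psize \<mu>" "t > 0"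
  shows "\<kappa> = \<mu>"
  using assms(1) unfolding hook_ge_def
proof (cases rule: rtranclp.cases)
  case (rtrancl_into_rtrancl \<nu>)
  then show ?thesis
    using psize_add_hook [of t \<nu> \<kappa>] hook_ge_psize [of t \<nu> \<mu>] assms by (simp add: hook_ge_def)
qed simp

text \<open>This matches the size condition in \<open>hook_paths\<close> with the single hooks in
  \<open>hook_diff\<close>: before the last hook the size is already that of \<open>\<nu>\<close>,
  so nothing was added earlier.\<close>

lemma hook_ge_one_hook:
  assumes "t > 0"
  shows "hook_ge t \<kappa> \<nu> \<and> psize \<kappa> = psize \<nu> + t \<longleftrightarrow> add_hook t \<nu> \<kappa>"
proof
  assume *: "hook_ge t \<kappa> \<nu> \<and> psize \<kappa> = psize \<nu> + t"
  then have "(add_hook t)\<^sup>*\<^sup>* \<nu> \<kappa>" by (simp add: hook_ge_def)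
  then show "add_hook t \<nu> \<kappa>"
  proof (cases rule: rtranclp.cases)
    case (rtrancl_into_rtrancl \<rho>)
    then have "\<rho> = \<nu>"
      using * psize_add_hook [of t \<rho> \<kappa>] assms
      by (intro hook_ge_psize_eq) (auto simp: hook_ge_def)
    then show ?thesis using rtrancl_into_rtrancl by simp
  qed (use * assms in simp)
qed (use assms psize_add_hook in \<open>auto simp: hook_ge_def\<close>)

lemma hook_sum_0:
  assumes "t > 0"
  shows "hook_sum t \<mu> g 0 = g \<mu>"
proof -
  have "{\<kappa>. hook_ge t \<kappa> \<mu> \<and> psize \<kappa> = psize \<mu> + 0 * t} = {\<mu>}"
    using hook_ge_psize_eq assms by (auto simp: hook_ge_def)
  then show ?thesis by (simp add: hook_sum_def hook_paths.simps)
qed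

text \<open>Expand the path counts on level \<open>n + 1\<close> over their predecessors on level
  \<open>n\<close> and exchange the sums; what remains inside is the sum of \<open>g\<close> over
  all ways to add a hook to \<open>\<nu>\<close>, that is
  \<open>g \<nu> + hook_diff t g \<nu>\<close>.\<close>

lemma hook_sum_Suc:
  assumes "t > 0"
  shows "hook_sum t \<mu> g (Suc n) = hook_sum t \<mu> g n + hook_sum t \<mu> (hook_diff t g) n"
proof -
  define L where "L n = {\<kappa>. hook_ge t \<kappa> \<mu> \<and> psize \<kappa> = psize \<mu> + n * t}" for n
  have fin: "finite (L n)" for n
    by (rule finite_subset [OF _ finite_psize [of "psize \<mu> + n * t"]]) (auto simp: L_def)
  have paths: "hook_paths t \<kappa> \<mu> = (\<Sum>\<nu> | \<nu> \<in> L n \<and> add_hook t \<nu> \<kappa>. hook_paths t \<nu> \<mu>)"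
    if "\<kappa> \<in> L (Suc n)" for \<kappa>
  proof -
    have "\<kappa> \<noteq> \<mu>" using that assms by (auto simp: L_def)
    moreover have "{\<nu>. hook_ge t \<kappa> \<nu> \<and> hook_ge t \<nu> \<mu> \<and> psize \<kappa> = psize \<nu> + t} =
        {\<nu>. \<nu> \<in> L n \<and> add_hook t \<nu> \<kappa>}"
      unfolding hook_ge_one_hook [OF assms, symmetric] using that by (auto simp: L_def)
    ultimately show ?thesis using assms by (subst hook_paths.simps) simp
  qed
  \<comment> \<open>Any hook added on level \<open>n\<close> leads to level \<open>n + 1\<close>, so
    the restriction left by the exchange disappears.\<close>
  have up: "{\<kappa>. \<kappa> \<in> L (Suc n) \<and> add_hook t \<nu> \<kappa>} = {\<kappa>. add_hook t \<nu> \<kappa>}" if "\<nu> \<in> L n" for \<nu>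
    using that psize_add_hook [OF _ assms] hook_ge_add_hook by (fastforce simp: L_def)
  have "hook_sum t \<mu> g (Suc n) =
      (\<Sum>\<kappa>\<in>L (Suc n). \<Sum>\<nu> | \<nu> \<in> L n \<and> add_hook t \<nu> \<kappa>. of_nat (hook_paths t \<nu> \<mu>) * g \<kappa>)"
    unfolding hook_sum_def L_def [symmetric] by (simp add: paths sum_distrib_right)
  also have "\<dots> = (\<Sum>\<nu>\<in>L n. \<Sum>\<kappa> | \<kappa> \<in> L (Suc n) \<and> add_hook t \<nu> \<kappa>. of_nat (hook_paths t \<nu> \<mu>) * g \<kappa>)"
    by (rule sum.swap_restrict) (rule fin)+
  also have "\<dots> = (\<Sum>\<nu>\<in>L n. of_nat (hook_paths t \<nu> \<mu>) * (g \<nu> + hook_diff t g \<nu>))"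
    by (simp add: up hook_diff_def sum_distrib_left)
  also have "\<dots> = hook_sum t \<mu> g n + hook_sum t \<mu> (hook_diff t g) n"
    unfolding hook_sum_def L_def [symmetric] by (simp add: sum.distrib algebra_simps)
  finally show ?thesis .
qed

lemma hook_sum_binomial:
  fixes g :: "partition \<Rightarrow> 'a :: field_char_0"
  assumes "t > 0"
  shows "hook_sum t \<mu> g n = (\<Sum>k\<le>n. of_nat (n choose k) * (hook_diff t ^^ k) g \<mu>)"
  using binomial_recursion [of "\<lambda>m n. hook_sum t \<mu> ((hook_diff t ^^ m) g) n" 1 0 n]
  by (simp add: hook_sum_Suc hook_sum_0 assms)

lemma hook_diff_binomial:
  fixes g :: "partition \<Rightarrow> 'a :: field_char_0"
  assumes "t > 0"
  shows "(hook_diff t ^^ n) g \<mu> = (\<Sum>k\<le>n. (- 1) ^ (n + k) * of_nat (n choose k) * hook_sum t \<mu> g k)"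
proof -
  have "(hook_diff t ^^ n) g \<mu> = (\<Sum>k\<le>n. of_nat (n choose k) * (- 1) ^ (n - k) * hook_sum t \<mu> g k)"
    \<comment> \<open>The indices are swapped: the recursion is solved for the sum with the higher
      difference, which puts \<open>- 1\<close> in front of the other sum on the same level.\<close>
    using binomial_recursion [of "\<lambda>m n. hook_sum t \<mu> ((hook_diff t ^^ n) g) m" "- 1" 0 n]
    by (simp add: hook_sum_Suc hook_sum_0 assms)
  also have "\<dots> = (\<Sum>k\<le>n. (- 1) ^ (n + k) * of_nat (n choose k) * hook_sum t \<mu> g k)"
    \<comment> \<open>For \<open>k \<le> n\<close> the numbers \<open>n - k\<close> and
      \<open>n + k\<close> have the same parity.\<close>
    by (intro sum.cong) (auto simp: minus_one_power_iff)
  finally show ?thesis .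
qed

text \<open>Adding hooks never leaves the set of partitions above \<open>\<mu>\<close>, so a further
  difference only combines values that are already zero.\<close>

lemma hook_diff_vanishes:
  assumes "\<And>\<kappa>. hook_ge t \<kappa> \<mu> \<Longrightarrow> (hook_diff t ^^ r) g \<kappa> = 0" "r \<le> k" "hook_ge t \<kappa> \<mu>"
  shows "(hook_diff t ^^ k) g \<kappa> = 0"
  using assms(2,3)
proof (induction k arbitrary: \<kappa> rule: dec_induct)
  case (step k)
  then show ?case by (auto simp: hook_diff_def intro!: sum.neutral hook_ge_add_hook)
qed (use assms in auto)

lemma hook_sum_polynomial:
  fixes g :: "partition \<Rightarrow> 'a :: field_char_0"
  assumes "t > 0" "\<And>\<kappa>. hook_ge t \<kappa> \<mu> \<Longrightarrow> (hook_diff t ^^ r) g \<kappa> = 0"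
  shows "\<exists>p :: 'a poly. \<forall>n. hook_sum t \<mu> g n = poly p (of_nat n)"
proof -
  obtain q :: "nat \<Rightarrow> 'a poly" where q: "\<And>k n. of_nat (n choose k) = poly (q k) (of_nat n)"
    using of_nat_binomial_poly by metis
  have zero: "(hook_diff t ^^ k) g \<mu> = 0" if "r \<le> k" for k
    by (rule hook_diff_vanishes [OF assms(2) that]) (auto simp: hook_ge_def)
  have "hook_sum t \<mu> g n = poly (\<Sum>k<r. smult ((hook_diff t ^^ k) g \<mu>) (q k)) (of_nat n)" for n
  proof -
    let ?f = "\<lambda>k. of_nat (n choose k) * (hook_diff t ^^ k) g \<mu>"
    \<comment> \<open>Passing through the union trades the range \<open>k \<le> n\<close> for the
      fixed range \<open>k < r\<close>: terms with \<open>k > n\<close> have binomial coefficient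
      \<open>0\<close>, those with \<open>k \<ge> r\<close> have vanishing difference.\<close>
    have "hook_sum t \<mu> g n = sum ?f ({..n} \<union> {..<r})"
      unfolding hook_sum_binomial [OF assms(1)]
      by (rule sum.mono_neutral_left) auto
    also have "\<dots> = sum ?f {..<r}"
      by (rule sum.mono_neutral_right) (use zero in \<open>auto simp: not_less\<close>)
    also have "\<dots> = poly (\<Sum>k<r. smult ((hook_diff t ^^ k) g \<mu>) (q k)) (of_nat n)"
      by (simp add: poly_sum q mult.commute)
    finally show ?thesis .
  qed
  then show ?thesis by blast
qed

theorem theorem2p3:
  fixes t :: nat and g :: "partition \<Rightarrow> 'a :: field_char_0" and \<mu> :: partition
  assumes "t > 0"
  shows "(\<forall>n. hook_sum t \<mu> g n = (\<Sum>k\<le>n. of_nat (n choose k) * (hook_diff t ^^ k) g \<mu>))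
    \<and> (\<forall>n. (hook_diff t ^^ n) g \<mu> = (\<Sum>k\<le>n. (- 1) ^ (n + k) * of_nat (n choose k) * hook_sum t \<mu> g k))
    \<and> ((\<exists>r>0. \<forall>\<kappa>. hook_ge t \<kappa> \<mu> \<longrightarrow> (hook_diff t ^^ r) g \<kappa> = 0) \<longrightarrow>
        (\<exists>p :: 'a poly. \<forall>n. hook_sum t \<mu> g n = poly p (of_nat n)))"
  using hook_sum_binomial [OF assms] hook_diff_binomial [OF assms] hook_sum_polynomial [OF assms]
  by blast

end
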